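(* Let $(X,p)$ be a partial metric space, let $\mathcal{I}$ be an admissible ideal of $\mathbb{N}$, let $r\ge 0$, and let $\{x_n\}$ be a sequence in $X$ that is rough $\mathcal{I}$-convergent of roughness degree $r$. Then $\mathcal{I}\text{-}LIM^{r}x_n$ is a closed subset of $X$.
   Context: A partial metric on a non-empty set $X$ is a function $p: X\times X \to [0,\infty)$ such that for all $x,y,z\in X$: (p1) $0\le p(x,x)\le p(x,y)$; (p2) $x=y$ if and only if $p(x,x)=p(x,y)=p(y,y)$; (p3) $p(x,y)=p(y,x)$; (p4) $p(x,y)\le p(x,z)+p(z,y)-p(z,z)$. Then $(X,p)$ is called a partial metric space. "Closed" refers to the topology on $X$ having as a base the open balls $B^{p}_{\rho}(x)=\{y\in X: p(x,y)<p(x,x)+\rho\}$, $x\in X$, $\rho>0$. An ideal of $\mathbb{N}$ is a family $\mathcal{I}\subset 2^{\mathbb{N}}$ with $\emptyset\in\mathcal{I}$, closed under finite unions and under taking subsets. It is non-trivial if $\mathbb{N}\notin\mathcal{I}$ and $\mathcal{I}\neq\{\emptyset\}$. An admissible ideal is a non-trivial ideal containing $\{n\}$ for every $n\in\mathbb{N}$. For $r\ge 0$, a sequence $\{x_n\}$ in $X$ is rough $\mathcal{I}$-convergent of roughness degree $r$ to $x\in X$ if for every $\varepsilon>0$ the set $\{n\in\mathbb{N}: |p(x_n,x)-p(x,x)|\ge r+\varepsilon\}$ belongs to $\mathcal{I}$; it is rough $\mathcal{I}$-convergent of roughness degree $r$ if it is so to some $x\in X$. The rough $\mathcal{I}$-limit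 set $\mathcal{I}\text{-}LIM^{r}x_n$ is the set of all $x\in X$ to which $\{x_n\}$ is rough $\mathcal{I}$-convergent of roughness degree $r$. *)

theory Defs
  imports "HOL-Analysis.Analysis"
begin

locale partial_metric_space =
  fixes X :: "'a set" and p :: "'a \<Rightarrow> 'a \<Rightarrow> real"
  assumes nonempty: "X \<noteq> {}"
    and self_nonneg: "x \<in> X \<Longrightarrow> 0 \<le> p x x"
    and self_le: "\<lbrakk>x \<in> X; y \<in> X\<rbrakk> \<Longrightarrow> p x x \<le> p x y"
    and eq_iff: "\<lbrakk>x \<in> X; y \<in> X\<rbrakk> \<Longrightarrow> x = y \<longleftrightarrow> p x x = p x y \<and> p x y = p y y"
    and commute: "\<lbrakk>x \<in> X; y \<in> X\<rbrakk> \<Longrightarrow> p x y = p y x"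
    and triangle: "\<lbrakk>x \<in> X; y \<in> X; z \<in> X\<rbrakk> \<Longrightarrow> p x y \<le> p x z + p z y - p z z"

definition pm_ball :: "'a set \<Rightarrow> ('a \<Rightarrow> 'a \<Rightarrow> real) \<Rightarrow> 'a \<Rightarrow> real \<Rightarrow> 'a set"
  where "pm_ball X p x \<rho> = {y \<in> X. p x y < p x x + \<rho>}"

definition is_pm_ball :: "'a set \<Rightarrow> ('a \<Rightarrow> 'a \<Rightarrow> real) \<Rightarrow> 'a set \<Rightarrow> bool"
  where "is_pm_ball X p U \<longleftrightarrow> (\<exists>x\<in>X. \<exists>\<rho>>0. U = pm_ball X p x \<rho>)"

text \<open>The open sets are the unions of open balls. As the constructor \<open>topology\<close> is only
  meaningful on families that do form a topology, \<open>openin_pm_topology\<close> and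
  \<open>topspace_pm_topology\<close> below confirm that the definition is as intended.\<close>

definition pm_topology :: "'a set \<Rightarrow> ('a \<Rightarrow> 'a \<Rightarrow> real) \<Rightarrow> 'a topology"
  where "pm_topology X p = topology (arbitrary union_of is_pm_ball X p)"

context partial_metric_space
begin

lemma pm_ball_subset_pm_ball:
  assumes "x \<in> X" "y \<in> pm_ball X p x \<rho>"
  shows "pm_ball X p y (p x x + \<rho> - p x y) \<subseteq> pm_ball X p x \<rho>"
proof
  fix w assume "w \<in> pm_ball X p y (p x x + \<rho> - p x y)"
  then show "w \<in> pm_ball X p x \<rho>"
    using assms triangle[of x w y] by (auto simp: pm_ball_def)
qed

lemma pm_ball_mono: "\<rho> \<le> \<sigma> \<Longrightarrow> pm_ball X p x \<rho> \<subseteq> pm_ball X p x \<sigma>"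
  by (auto simp: pm_ball_def)

lemma centre_in_pm_ball: "\<lbrakk>x \<in> X; \<rho> > 0\<rbrakk> \<Longrightarrow> x \<in> pm_ball X p x \<rho>"
  by (simp add: pm_ball_def)

lemma istopology_pm: "istopology (arbitrary union_of is_pm_ball X p)"
  unfolding istopology_base_eq
proof (intro allI impI)
  fix S T assume "is_pm_ball X p S \<and> is_pm_ball X p T"
  then obtain x \<rho> z \<sigma> where x: "x \<in> X" "S = pm_ball X p x \<rho>"
    and z: "z \<in> X" "T = pm_ball X p z \<sigma>"
    unfolding is_pm_ball_def by blast
  have "\<exists>U. is_pm_ball X p U \<and> y \<in> U \<and> U \<subseteq> S \<inter> T" if y: "y \<in> S \<inter> T" for y
  proof -
    define d where "d = min (p x x + \<rho> - p x y) (p z z + \<sigma> - p z y)"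
    have "y \<in> X" "d > 0"
      using y x z by (auto simp: pm_ball_def d_def)
    moreover have "pm_ball X p y d \<subseteq> S \<inter> T"
      using pm_ball_subset_pm_ball[of x y \<rho>] pm_ball_subset_pm_ball[of z y \<sigma>] x z y
        pm_ball_mono[of d "p x x + \<rho> - p x y" y] pm_ball_mono[of d "p z z + \<sigma> - p z y" y]
      by (auto simp: d_def)
    ultimately show ?thesis
      using centre_in_pm_ball is_pm_ball_def by blast
  qed
  then have "S \<inter> T = \<Union>{U. is_pm_ball X p U \<and> U \<subseteq> S \<inter> T}"
    by blast
  then show "(arbitrary union_of is_pm_ball X p) (S \<inter> T)"
    unfolding union_of_def arbitrary_def
    by (intro exI[of _ "{U. is_pm_ball X p U \<and> U \<subseteq> S \<inter> T}"]) auto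
qed

lemma openin_pm_topology: "openin (pm_topology X p) = arbitrary union_of is_pm_ball X p"
  unfolding pm_topology_def using istopology_pm by (rule topology_inverse')

lemma topspace_pm_topology: "topspace (pm_topology X p) = X"
proof
  show "topspace (pm_topology X p) \<subseteq> X"
    unfolding topspace_def openin_pm_topology union_of_def is_pm_ball_def pm_ball_def by blast
  show "X \<subseteq> topspace (pm_topology X p)"
  proof
    fix x assume "x \<in> X"
    then have "is_pm_ball X p (pm_ball X p x 1)" "x \<in> pm_ball X p x 1"
      using centre_in_pm_ball by (auto simp: is_pm_ball_def intro: zero_less_one)
    then show "x \<in> topspace (pm_topology X p)"
      unfolding topspace_def openin_pm_topology by (blast intro: arbitrary_union_of_inc)
  qed
qed

end

definition nat_ideal :: "nat set set \<Rightarrow> bool"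
  where "nat_ideal \<I> \<longleftrightarrow>
    {} \<in> \<I> \<and> (\<forall>A\<in>\<I>. \<forall>B\<in>\<I>. A \<union> B \<in> \<I>) \<and> (\<forall>A\<in>\<I>. \<forall>B. B \<subseteq> A \<longrightarrow> B \<in> \<I>)"

definition nontrivial_nat_ideal :: "nat set set \<Rightarrow> bool"
  where "nontrivial_nat_ideal \<I> \<longleftrightarrow> nat_ideal \<I> \<and> UNIV \<notin> \<I> \<and> \<I> \<noteq> {{}}"

definition admissible_nat_ideal :: "nat set set \<Rightarrow> bool"
  where "admissible_nat_ideal \<I> \<longleftrightarrow> nontrivial_nat_ideal \<I> \<and> (\<forall>n. {n} \<in> \<I>)"

definition rough_ideal_converges_to ::
    "('a \<Rightarrow> 'a \<Rightarrow> real) \<Rightarrow> nat set set \<Rightarrow> real \<Rightarrow> (nat \<Rightarrow> 'a) \<Rightarrow> 'a \<Rightarrow> bool"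
  where "rough_ideal_converges_to p \<I> r x l \<longleftrightarrow>
    (\<forall>\<epsilon>>0. {n. \<bar>p (x n) l - p l l\<bar> \<ge> r + \<epsilon>} \<in> \<I>)"

definition rough_ideal_LIM ::
    "'a set \<Rightarrow> ('a \<Rightarrow> 'a \<Rightarrow> real) \<Rightarrow> nat set set \<Rightarrow> real \<Rightarrow> (nat \<Rightarrow> 'a) \<Rightarrow> 'a set"
  where "rough_ideal_LIM X p \<I> r x = {l \<in> X. rough_ideal_converges_to p \<I> r x l}"

definition rough_ideal_convergent ::
    "'a set \<Rightarrow> ('a \<Rightarrow> 'a \<Rightarrow> real) \<Rightarrow> nat set set \<Rightarrow> real \<Rightarrow> (nat \<Rightarrow> 'a) \<Rightarrow> bool"
  where "rough_ideal_convergent X p \<I> r x \<longleftrightarrow> (\<exists>l\<in>X. rough_ideal_converges_to p \<I> r x l)"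

end

theory Submission
  imports Defs
begin

text \<open>Write \<open>e l y = p y l - p l l \<ge> 0\<close> for the excess of \<open>y\<close> over \<open>l\<close>; it measures how far \<open>y\<close> is
  from \<open>l\<close> in the balls around \<open>l\<close>, and rough convergence to \<open>l\<close> bounds \<open>e l (x n)\<close> by about \<open>r\<close>
  off a small set of indices. The triangle inequality through \<open>y\<close> says exactly that
  \<open>e l z \<le> e y z + e l y\<close>: the correction term \<open>- p y y\<close> is the one that turns \<open>p z y\<close> into
  an excess over \<open>y\<close>. So the excess is a quasi-metric, and if rough limits \<open>y\<close> occur in
  arbitrarily small balls around \<open>l\<close>, then choosing \<open>y\<close> with \<open>e l y < \<epsilon> / 2\<close> costs only \<open>\<epsilon> / 2\<close>
  in the bound on the excess, so \<open>l\<close> is itself a rough limit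
  (\<open>rough_ideal_LIM_adherent\<close>). As balls centred at the points of a set decide whether it is
  open, this is closedness (\<open>closedin_pm_topologyI\<close>).\<close>

context partial_metric_space
begin

lemma closedin_pm_topologyI:
  assumes "C \<subseteq> X"
    and adherent: "\<And>l. \<lbrakk>l \<in> X; \<And>\<rho>. \<rho> > 0 \<Longrightarrow> pm_ball X p l \<rho> \<inter> C \<noteq> {}\<rbrakk> \<Longrightarrow> l \<in> C"
  shows "closedin (pm_topology X p) C"
proof -
  have "openin (pm_topology X p) (X - C)"
  proof (subst openin_subopen, intro ballI)
    fix l assume l: "l \<in> X - C"
    then obtain \<rho> where \<rho>: "\<rho> > 0" "pm_ball X p l \<rho> \<inter> C = {}"
      using adherent by blast
    have "openin (pm_topology X p) (pm_ball X p l \<rho>)"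
      unfolding openin_pm_topology
      by (rule arbitrary_union_of_inc) (use l \<rho> in \<open>auto simp: is_pm_ball_def\<close>)
    moreover have "l \<in> pm_ball X p l \<rho>"
      using l \<rho> centre_in_pm_ball by blast
    moreover have "pm_ball X p l \<rho> \<subseteq> X - C"
      using \<rho> by (auto simp: pm_ball_def)
    ultimately show "\<exists>T. openin (pm_topology X p) T \<and> l \<in> T \<and> T \<subseteq> X - C"
      by blast
  qed
  then show ?thesis
    using \<open>C \<subseteq> X\<close> by (simp add: closedin_def topspace_pm_topology)
qed

lemma excess_nonneg:
  assumes "l \<in> X" "y \<in> X"
  shows "0 \<le> p y l - p l l"
  using self_le[of l y] commute[of l y] assms by simp

lemma excess_triangle:
  assumes "l \<in> X" "y \<in> X" "z \<in> X"
  shows "p z l - p l l \<le> (p z y - p y y) + (p y l - p l l)"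
  using triangle[of z l y] assms by simp

text \<open>Let \<open>y\<close> be a rough limit with excess below \<open>\<epsilon> / 2\<close> over \<open>l\<close>. An index at which the excess
  over \<open>l\<close> is at least \<open>r + \<epsilon>\<close> has excess at least \<open>r + \<epsilon> / 2\<close> over \<open>y\<close>, so the exceptional set
  of \<open>l\<close> for \<open>\<epsilon>\<close> lies inside that of \<open>y\<close> for \<open>\<epsilon> / 2\<close>, and the ideal is closed under subsets.\<close>

lemma rough_ideal_LIM_adherent:
  assumes ideal: "nat_ideal \<I>"
    and x: "\<And>n. x n \<in> X"
    and l: "l \<in> X"
    and meets: "\<And>\<rho>. \<rho> > 0 \<Longrightarrow> pm_ball X p l \<rho> \<inter> rough_ideal_LIM X p \<I> r x \<noteq> {}"
  shows "l \<in> rough_ideal_LIM X p \<I> r x"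
proof -
  have "{n. \<bar>p (x n) l - p l l\<bar> \<ge> r + \<epsilon>} \<in> \<I>" if "\<epsilon> > 0" for \<epsilon>
  proof -
    obtain y where y: "y \<in> X" "p l y < p l l + \<epsilon> / 2" "rough_ideal_converges_to p \<I> r x y"
      using meets[of "\<epsilon> / 2"] \<open>\<epsilon> > 0\<close> by (auto simp: pm_ball_def rough_ideal_LIM_def)
    have "{n. \<bar>p (x n) l - p l l\<bar> \<ge> r + \<epsilon>} \<subseteq> {n. \<bar>p (x n) y - p y y\<bar> \<ge> r + \<epsilon> / 2}"
    proof (intro subsetI CollectI)
      fix n assume "n \<in> {n. \<bar>p (x n) l - p l l\<bar> \<ge> r + \<epsilon>}"
      then show "\<bar>p (x n) y - p y y\<bar> \<ge> r + \<epsilon> / 2"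
        using excess_triangle[OF l y(1) x[of n]] excess_nonneg[OF l x[of n]]
          commute[OF l y(1)] y(2) by auto
    qed
    moreover have "{n. \<bar>p (x n) y - p y y\<bar> \<ge> r + \<epsilon> / 2} \<in> \<I>"
      using y(3) \<open>\<epsilon> > 0\<close> by (simp add: rough_ideal_converges_to_def)
    ultimately show ?thesis
      using ideal unfolding nat_ideal_def by blast
  qed
  then show ?thesis
    using l by (simp add: rough_ideal_LIM_def rough_ideal_converges_to_def)
qed

end

theorem theorem3p4:
  fixes X :: "'a set" and p :: "'a \<Rightarrow> 'a \<Rightarrow> real"
    and \<I> :: "nat set set" and r :: real and x :: "nat \<Rightarrow> 'a"
  assumes "partial_metric_space X p"
    and "admissible_nat_ideal \<I>"
    and "r \<ge> 0"
    and "\<And>n. x n \<in> X"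
    and "rough_ideal_convergent X p \<I> r x"
  shows "closedin (pm_topology X p) (rough_ideal_LIM X p \<I> r x)"
proof -
  interpret partial_metric_space X p by fact
  have ideal: "nat_ideal \<I>"
    using assms(2) by (simp add: admissible_nat_ideal_def nontrivial_nat_ideal_def)
  show ?thesis
  proof (rule closedin_pm_topologyI)
    show "rough_ideal_LIM X p \<I> r x \<subseteq> X"
      by (auto simp: rough_ideal_LIM_def)
  qed (rule rough_ideal_LIM_adherent[OF ideal assms(4)])
qed

end
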